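(* Let $d\ge 1$ be an integer and $\beta \in (0,d]$. For each $\alpha \in [d-\beta,d)$ and each $C'>0$ there exists a constant $C=C(\alpha,\beta,d,C')>0$ such that $$\left\|\sup_{t>0} t^{\alpha/2} |e^{t\Delta} \mu| \right\|_{L^1(\nu)} \leq C \|\mu\|_{DS_\beta(\mathbb{R}^d)}$$ for all (nonnegative) Radon measures $\nu$ on $\mathbb{R}^d$ such that $\nu(B(x,r))\leq C'r^{d-\alpha}$ for every ball $B(x,r)\subset\mathbb{R}^d$, and all $\mu \in DS_\beta(\mathbb{R}^d)$.
   Context: $M_b(\mathbb{R}^d)$ is the space of finite (signed) Radon measures on $\mathbb{R}^d$; $|\mu|$ denotes total variation. $e^{t\Delta}$, $t>0$, is the heat semigroup: $e^{t\Delta}\mu(x)=\int_{\mathbb{R}^d}(4\pi t)^{-d/2}e^{-|x-y|^2/4t}\,d\mu(y)$. $\beta$-atom ($\beta\in(0,d]$): a measure $a\in M_b(\mathbb{R}^d)$ for which there is a cube $Q\subset\mathbb{R}^d$ with sides parallel to the coordinate axes, of side length $l(Q)$, such that (1) $\operatorname{supp} a\subset Q$; (2) $a(Q)=0$; (3) $\sup_{x\in\mathbb{R}^d,\,t>0}|t^{(d-\beta)/2}e^{t\Delta}a(x)|\le l(Q)^{-\beta}$; (4) $|a|(\mathbb{R}^d)\le 1$. $DS_\beta(\mathbb{R}^d)$ is the set of $\mu\in M_b(\mathbb{R}^d)$ for which there are scalars $\lambda_{i,n}$ and $\beta$-atoms $a_{i,n}$ ($1\le i\le n$, $n\in\mathbb{N}$)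 with $\limsup_{n\to\infty}\sum_{i=1}^n|\lambda_{i,n}|<+\infty$ and $\mu=\lim_{n\to\infty}\sum_{i=1}^n\lambda_{i,n}a_{i,n}$ weakly-star as measures, i.e. $\int\varphi\,d\mu=\lim_{n\to\infty}\sum_{i=1}^n\lambda_{i,n}\int\varphi\,da_{i,n}$ for all $\varphi\in C_0(\mathbb{R}^d)$. Its norm $\|\mu\|_{DS_\beta(\mathbb{R}^d)}$ is the infimum of $\limsup_{n\to\infty}\sum_{i=1}^n|\lambda_{i,n}|$ over all such representations of $\mu$. *)

theory Defs
  imports "HOL-Analysis.Analysis"
begin

definition radon_measure :: "'a::euclidean_space measure \<Rightarrow> bool" where
  "radon_measure M \<longleftrightarrow>
     sets M = sets borel \<and>
     (\<forall>K. compact K \<longrightarrow> emeasure M K < \<infinity>) \<and>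
     (\<forall>E\<in>sets borel. emeasure M E = (SUP K\<in>{K. compact K \<and> K \<subseteq> E}. emeasure M K))"

text \<open>
  A signed measure is a real-valued set function, of which only the values on Borel sets
  are relevant. For a countably additive \<open>\<mu>\<close>, the set functions passed to \<^const>\<open>measure_of\<close>
  in \<open>variation\<close> and \<open>pos_part\<close> are countably additive on the Borel sets, so they are the
  values of the resulting measures there.
\<close>

definition variation :: "('a::euclidean_space set \<Rightarrow> real) \<Rightarrow> 'a measure" where
  "variation \<mu> = measure_of UNIV (sets borel)
     (\<lambda>E. SUP P\<in>{P. finite P \<and> disjoint P \<and> P \<subseteq> sets borel \<and> \<Union>P = E}.
            \<Sum>A\<in>P. ennreal \<bar>\<mu> A\<bar>)"

text \<open>The Jordan decomposition of \<open>\<mu>\<close> is \<open>pos_part \<mu>\<close>, \<open>neg_part \<mu>\<close>. Negative values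
  are truncated to 0 by \<^const>\<open>ennreal\<close>, harmlessly, as \<open>F = {}\<close> is admitted.\<close>

definition pos_part :: "('a::euclidean_space set \<Rightarrow> real) \<Rightarrow> 'a measure" where
  "pos_part \<mu> = measure_of UNIV (sets borel)
     (\<lambda>E. SUP F\<in>{F\<in>sets borel. F \<subseteq> E}. ennreal (\<mu> F))"

definition neg_part :: "('a::euclidean_space set \<Rightarrow> real) \<Rightarrow> 'a measure" where
  "neg_part \<mu> = pos_part (\<lambda>E. - \<mu> E)"

definition signed_integral :: "('a::euclidean_space set \<Rightarrow> real) \<Rightarrow> ('a \<Rightarrow> real) \<Rightarrow> real" where
  "signed_integral \<mu> f = integral\<^sup>L (pos_part \<mu>) f - integral\<^sup>L (neg_part \<mu>) f"

definition signed_radon_measures :: "('a::euclidean_space set \<Rightarrow> real) set" where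
  "signed_radon_measures =
     {\<mu>. \<mu> {} = 0 \<and>
         (\<forall>A :: nat \<Rightarrow> 'a set. range A \<subseteq> sets borel \<longrightarrow> disjoint_family A \<longrightarrow>
            (\<lambda>n. \<mu> (A n)) sums \<mu> (\<Union>n. A n)) \<and>
         radon_measure (variation \<mu>)}"

definition signed_support :: "('a::euclidean_space set \<Rightarrow> real) \<Rightarrow> 'a set" where
  "signed_support \<mu> = {x. \<forall>U. open U \<longrightarrow> x \<in> U \<longrightarrow> emeasure (variation \<mu>) U > 0}"

definition heat :: "real \<Rightarrow> ((real ^ 'n) set \<Rightarrow> real) \<Rightarrow> real ^ 'n \<Rightarrow> real" where
  "heat t \<mu> x = signed_integral \<mu>
     (\<lambda>y. (4 * pi * t) powr (- (real CARD('n) / 2)) * exp (- (norm (x - y))\<^sup>2 / (4 * t)))"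

definition beta_atom :: "real \<Rightarrow> ((real ^ 'n) set \<Rightarrow> real) \<Rightarrow> bool" where
  "beta_atom \<beta> a \<longleftrightarrow> a \<in> signed_radon_measures \<and>
     (\<exists>c l. l > 0 \<and>
       (let Q = cbox c (\<chi> i. c $ i + l) in
          signed_support a \<subseteq> Q \<and>
          a Q = 0 \<and>
          (\<forall>x. \<forall>t>0. \<bar>t powr ((real CARD('n) - \<beta>) / 2) * heat t a x\<bar> \<le> l powr (- \<beta>)) \<and>
          emeasure (variation a) UNIV \<le> 1))"

definition C0_functions :: "('a::euclidean_space \<Rightarrow> real) set" where
  "C0_functions = {\<phi>. continuous_on UNIV \<phi> \<and> (\<phi> \<longlongrightarrow> 0) at_infinity}"

definition atomic_limsup :: "(nat \<Rightarrow> nat \<Rightarrow> real) \<Rightarrow> ennreal" where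
  "atomic_limsup c = limsup (\<lambda>n. ennreal (\<Sum>i=1..n. \<bar>c i n\<bar>))"

definition atomic_representation ::
    "real \<Rightarrow> ((real ^ 'n) set \<Rightarrow> real) \<Rightarrow>
     (nat \<Rightarrow> nat \<Rightarrow> real) \<Rightarrow> (nat \<Rightarrow> nat \<Rightarrow> (real ^ 'n) set \<Rightarrow> real) \<Rightarrow> bool" where
  "atomic_representation \<beta> \<mu> c a \<longleftrightarrow>
     (\<forall>n. \<forall>i\<in>{1..n}. beta_atom \<beta> (a i n)) \<and>
     atomic_limsup c < \<infinity> \<and>
     (\<forall>\<phi>\<in>C0_functions.
        (\<lambda>n. \<Sum>i=1..n. c i n * signed_integral (a i n) \<phi>) \<longlonglongrightarrow> signed_integral \<mu> \<phi>)"

definition DS :: "real \<Rightarrow> ((real ^ 'n) set \<Rightarrow> real) set" where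
  "DS \<beta> = {\<mu>\<in>signed_radon_measures. \<exists>c a. atomic_representation \<beta> \<mu> c a}"

definition DS_norm :: "real \<Rightarrow> ((real ^ 'n) set \<Rightarrow> real) \<Rightarrow> ennreal" where
  "DS_norm \<beta> \<mu> = Inf {atomic_limsup c | c a. atomic_representation \<beta> \<mu> c a}"

end

theory Submission
  imports Defs
begin

text \<open>
  Write \<open>d = CARD('n)\<close> and \<open>s = d - \<alpha>\<close>, so that \<open>s > 0\<close> and \<open>\<nu>\<close> gives mass at most \<open>C' * r powr s\<close>
  to balls of radius \<open>r\<close>. The estimate is proved for a single atom \<open>a\<close>, with a constant depending only
  on \<open>d\<close>, \<open>\<alpha>\<close> and \<open>C'\<close>, and then transferred to weak-star limits of combinations of atoms.

  Let \<open>a\<close> live on a cube with corner \<open>c\<close> and side \<open>l\<close>. At every point the maximal function of \<open>a\<close> is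
  at most \<open>l powr (- s)\<close>: for \<open>t \<le> l\<^sup>2\<close> this follows from the smoothness condition on atoms, because
  \<open>\<alpha> \<ge> d - \<beta>\<close>, and for \<open>t > l\<^sup>2\<close> from the size \<open>t powr (- d / 2)\<close> of the heat kernel. At a distance
  \<open>R\<close> from \<open>c\<close> that is large compared with \<open>l\<close>, the condition \<open>a(Q) = 0\<close> allows one to subtract the
  value of the kernel at \<open>c\<close>, and the mean value theorem gives a bound by a multiple of
  \<open>l * R powr (- s - 1)\<close> (\<open>beta_atom_heat_bounds\<close>). Summing over dyadic annuli
  (\<open>dyadic_domination\<close>), the first bound contributes \<open>l powr (- s) * l powr s = 1\<close> and the second a
  convergent geometric series, up to constants.

  For a general \<open>\<mu>\<close>, the heat kernel with pole \<open>x\<close> at time \<open>t\<close> is a test function vanishing at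
  infinity, so \<open>heat t \<mu> x\<close> is the limit of the corresponding combinations for atoms. Hence the maximal
  function of \<open>\<mu>\<close> is at most the lower limit of the combinations of the maximal functions of the atoms,
  and Fatou's lemma concludes (\<open>maximal_integral_le_atomic_limsup\<close>).

  The cancellation argument needs the integral against \<open>a\<close> to be controlled by the total variation, and
  \<open>a(Q) = 0\<close> to imply that constants integrate to zero. Both come from the Jordan decomposition, which is
  established first, directly from the suprema that define the two parts and the variation.
\<close>

section \<open>Jordan decomposition of a signed measure\<close>

lemma SUP_add_SUP_least:
  fixes f :: "'b \<Rightarrow> ennreal" and g :: "'c \<Rightarrow> ennreal"
  assumes "I \<noteq> {}" "J \<noteq> {}"
    and "\<And>i j. i \<in> I \<Longrightarrow> j \<in> J \<Longrightarrow> f i + g j \<le> u"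
  shows "(SUP i\<in>I. f i) + (SUP j\<in>J. g j) \<le> u"
  using assms by (auto simp: ennreal_SUP_add_left[symmetric] ennreal_SUP_add_right intro!: SUP_least)

locale signed_measure =
  fixes \<mu> :: "'a::euclidean_space set \<Rightarrow> real"
  assumes empty: "\<mu> {} = 0"
    and sigma_additive: "\<And>A :: nat \<Rightarrow> 'a set. range A \<subseteq> sets borel \<Longrightarrow> disjoint_family A \<Longrightarrow>
          (\<lambda>n. \<mu> (A n)) sums \<mu> (\<Union>n. A n)"
begin

lemma additive:
  assumes "A \<in> sets borel" "B \<in> sets borel" "A \<inter> B = {}"
  shows "\<mu> (A \<union> B) = \<mu> A + \<mu> B"
proof -
  have "disjoint_family (binaryset A B)"
    using assms by (auto simp: disjoint_family_on_def binaryset_def)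
  then have "(\<lambda>n. \<mu> (binaryset A B n)) sums \<mu> (A \<union> B)"
    using sigma_additive[of "binaryset A B"] assms
    by (simp add: range_binaryset_eq UN_binaryset_eq)
  moreover have "(\<lambda>n. \<mu> (binaryset A B n)) sums (\<Sum>n\<in>{0, 1}. \<mu> (binaryset A B n))"
    by (rule sums_finite) (auto simp: binaryset_def empty)
  then have "(\<lambda>n. \<mu> (binaryset A B n)) sums (\<mu> A + \<mu> B)"
    by (simp add: binaryset_def)
  ultimately show ?thesis by (rule sums_unique2)
qed

lemma diff:
  assumes "A \<in> sets borel" "B \<in> sets borel" "B \<subseteq> A"
  shows "\<mu> (A - B) = \<mu> A - \<mu> B"
proof -
  have "(A - B) \<union> B = A" using assms by auto
  then show ?thesis using additive[of "A - B" B] assms by (simp add: sets.Diff Diff_Int_distrib2)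
qed

lemma uminus: "signed_measure (\<lambda>E. - \<mu> E)"
  using empty sigma_additive by unfold_locales (auto intro: sums_minus)

text \<open>
  The value of the positive part of \<open>\<mu>\<close> on \<open>E\<close>. Countable additivity of this set function is
  what makes the measures built from it take the expected values.
\<close>

definition upper :: "'a set \<Rightarrow> ennreal" where
  "upper E = (SUP F\<in>{F\<in>sets borel. F \<subseteq> E}. ennreal (\<mu> F))"

lemma le_upper: "F \<in> sets borel \<Longrightarrow> F \<subseteq> E \<Longrightarrow> ennreal (\<mu> F) \<le> upper E"
  unfolding upper_def by (rule SUP_upper) auto

lemma upper_le: "(\<And>F. F \<in> sets borel \<Longrightarrow> F \<subseteq> E \<Longrightarrow> ennreal (\<mu> F) \<le> u) \<Longrightarrow> upper E \<le> u"
  unfolding upper_def by (rule SUP_least) auto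

lemma borel_subsets_nonempty: "{F \<in> sets borel. F \<subseteq> E} \<noteq> {}"
  using sets.empty_sets by blast

text \<open>
  Optimal subsets of two disjoint sets combine to a competitor for the union; a subset of
  negative value, which \<^const>\<open>ennreal\<close> truncates, is replaced by the empty set.
\<close>

lemma upper_superadditive:
  assumes "A \<in> sets borel" "B \<in> sets borel" "A \<inter> B = {}"
  shows "upper A + upper B \<le> upper (A \<union> B)"
proof -
  have "ennreal (\<mu> F) + ennreal (\<mu> G) \<le> upper (A \<union> B)"
    if "F \<in> sets borel" "F \<subseteq> A" "G \<in> sets borel" "G \<subseteq> B" for F G
  proof -
    have "F \<inter> G = {}" using that assms by auto
    then have eq: "\<mu> (F \<union> G) = \<mu> F + \<mu> G" using that additive by auto
    consider "\<mu> F \<ge> 0" "\<mu> G \<ge> 0" | "\<mu> F < 0" | "\<mu> G < 0" by linarith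
    then show ?thesis
    proof cases
      case 1
      have "F \<union> G \<subseteq> A \<union> B" using that by auto
      then show ?thesis using le_upper[of "F \<union> G" "A \<union> B"] that eq 1 by simp
    next
      case 2
      then show ?thesis using le_upper[of G "A \<union> B"] that by (simp add: ennreal_neg le_supI2)
    next
      case 3
      then show ?thesis using le_upper[of F "A \<union> B"] that by (simp add: ennreal_neg le_supI1)
    qed
  qed
  then show ?thesis
    unfolding upper_def[of A] upper_def[of B]
    by (rule SUP_add_SUP_least[OF borel_subsets_nonempty borel_subsets_nonempty]) simp_all
qed

lemma upper_mono: "A \<subseteq> B \<Longrightarrow> upper A \<le> upper B"
  unfolding upper_def by (rule SUP_subset_mono) auto

lemma upper_empty: "upper {} = 0"
  using upper_le[of "{}" 0] by (simp add: empty)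

text \<open>
  One inequality is superadditivity passed to the limit. For the other, a competitor \<open>F\<close> for the
  union is cut into the pieces \<open>F \<inter> A n\<close>, each of which competes in its own \<open>A n\<close>.
\<close>

lemma upper_countably_additive: "countably_additive (sets borel) upper"
  unfolding countably_additive_def
proof (intro allI impI antisym)
  fix A :: "nat \<Rightarrow> 'a set"
  assume A: "range A \<subseteq> sets borel" "disjoint_family A"
  have finite_sum: "(\<Sum>n<k. upper (A n)) \<le> upper (\<Union>n<k. A n)" for k
  proof (induction k)
    case 0
    then show ?case by simp
  next
    case (Suc k)
    have "A n \<inter> A k = {}" if "n < k" for n
      using disjoint_family_onD[OF A(2), of n k] that by simp
    then have "(\<Union>n<k. A n) \<inter> A k = {}"
      by blast
    have "(\<Sum>n<Suc k. upper (A n)) = (\<Sum>n<k. upper (A n)) + upper (A k)"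
      by simp
    also have "\<dots> \<le> upper (\<Union>n<k. A n) + upper (A k)"
      by (rule add_right_mono[OF Suc])
    also have "\<dots> \<le> upper ((\<Union>n<k. A n) \<union> A k)"
      using A(1) \<open>(\<Union>n<k. A n) \<inter> A k = {}\<close> by (intro upper_superadditive) auto
    also have "(\<Union>n<k. A n) \<union> A k = (\<Union>n<Suc k. A n)"
      by (auto simp: less_Suc_eq)
    finally show ?case .
  qed
  have "(\<Sum>n<k. upper (A n)) \<le> upper (\<Union>n. A n)" for k
    by (rule order_trans[OF finite_sum upper_mono]) auto
  then show "(\<Sum>n. upper (A n)) \<le> upper (\<Union>n. A n)"
    by (intro suminf_le_const summableI)
  show "upper (\<Union>n. A n) \<le> (\<Sum>n. upper (A n))"
  proof (rule upper_le)
    fix F :: "'a set" assume F: "F \<in> sets borel" "F \<subseteq> (\<Union>n. A n)"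
    have "disjoint_family (\<lambda>n. F \<inter> A n)"
      by (rule disjoint_family_subset[OF A(2)]) simp
    moreover have "range (\<lambda>n. F \<inter> A n) \<subseteq> sets borel"
      using F A(1) by (simp add: image_subset_iff)
    ultimately have "(\<lambda>n. \<mu> (F \<inter> A n)) sums \<mu> (\<Union>n. F \<inter> A n)"
      by (intro sigma_additive)
    moreover have "(\<Union>n. F \<inter> A n) = F" using F by auto
    ultimately have "(\<lambda>k. ennreal (\<Sum>n<k. \<mu> (F \<inter> A n))) \<longlonglongrightarrow> ennreal (\<mu> F)"
      by (intro tendsto_ennrealI) (simp add: sums_def)
    moreover have "ennreal (\<Sum>n<k. \<mu> (F \<inter> A n)) \<le> (\<Sum>n. upper (A n))" for k
    proof -
      have "ennreal (\<Sum>n<k. \<mu> (F \<inter> A n)) \<le> ennreal (\<Sum>n<k. max 0 (\<mu> (F \<inter> A n)))"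
        by (intro ennreal_leI sum_mono) auto
      also have "\<dots> = (\<Sum>n<k. ennreal (max 0 (\<mu> (F \<inter> A n))))"
        by (rule sum_ennreal[symmetric]) simp
      also have "\<dots> = (\<Sum>n<k. ennreal (\<mu> (F \<inter> A n)))"
        by (rule sum.cong) (auto simp: max_def ennreal_neg)
      also have "\<dots> \<le> (\<Sum>n<k. upper (A n))"
        using F A(1) by (intro sum_mono le_upper) (simp_all add: image_subset_iff)
      also have "\<dots> \<le> (\<Sum>n. upper (A n))"
        by (rule sum_le_suminf) auto
      finally show ?thesis .
    qed
    ultimately show "ennreal (\<mu> F) \<le> (\<Sum>n. upper (A n))"
      by - (rule LIMSEQ_le_const2, auto)
  qed
qed

lemma pos_part_eq: "pos_part \<mu> = measure_of UNIV (sets borel) upper"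
  unfolding pos_part_def upper_def ..

lemma sets_pos_part [simp]: "sets (pos_part \<mu>) = sets borel"
  unfolding pos_part_eq by (simp add: sets.sigma_sets_eq[of borel, simplified])

lemma emeasure_pos_part: "E \<in> sets borel \<Longrightarrow> emeasure (pos_part \<mu>) E = upper E"
  using upper_countably_additive upper_empty
  by (intro emeasure_measure_of[OF pos_part_eq]) (auto simp: positive_def)

end

context signed_measure
begin

interpretation neg: signed_measure "\<lambda>E. - \<mu> E"
  by (rule uminus)

lemma sets_neg_part [simp]: "sets (neg_part \<mu>) = sets borel"
  unfolding neg_part_def by simp

lemma emeasure_neg_part: "E \<in> sets borel \<Longrightarrow> emeasure (neg_part \<mu>) E = neg.upper E"
  unfolding neg_part_def by (rule neg.emeasure_pos_part)

text \<open>
  Replacing \<open>F \<subseteq> E\<close> by its complement in \<open>E\<close> turns a competitor for the positive part into one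
  for the negative part, at the cost of \<open>\<mu> E\<close>. Used for \<open>\<mu>\<close> and for \<open>- \<mu>\<close>, this yields the Jordan
  decomposition without a Hahn set.
\<close>

lemma upper_le_add_lower:
  assumes "E \<in> sets borel" "0 \<le> n" "neg.upper E = ennreal n"
  shows "upper E \<le> ennreal (\<mu> E + n)"
proof (rule upper_le)
  fix F assume F: "F \<in> sets borel" "F \<subseteq> E"
  have "ennreal (- \<mu> (E - F)) \<le> ennreal n"
    using neg.le_upper[of "E - F" E] F assms by auto
  then have "\<mu> F \<le> \<mu> E + n"
    using diff[of E F] F assms by simp
  then show "ennreal (\<mu> F) \<le> ennreal (\<mu> E + n)"
    by (rule ennreal_leI)
qed

text \<open>
  This identifies the total variation with the sum of the two parts, so that its countable
  additivity is inherited from theirs. A partition is estimated set by set. Conversely, competitors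
  \<open>F\<close> and \<open>G\<close> for the two parts are compared with a partition containing \<open>F - G\<close> and \<open>G - F\<close>.
\<close>

lemma variation_sum_eq:
  assumes E: "E \<in> sets borel"
  shows "(SUP P\<in>{P. finite P \<and> disjoint P \<and> P \<subseteq> sets borel \<and> \<Union>P = E}.
            \<Sum>A\<in>P. ennreal \<bar>\<mu> A\<bar>) = upper E + neg.upper E" (is "?V = _")
proof (rule antisym)
  show "?V \<le> upper E + neg.upper E"
  proof (rule SUP_least)
    fix P :: "'a set set"
    assume "P \<in> {P. finite P \<and> disjoint P \<and> P \<subseteq> sets borel \<and> \<Union>P = E}"
    then have P: "finite P" "disjoint P" "P \<subseteq> sets borel" "\<Union>P = E"
      by auto
    have "ennreal \<bar>\<mu> A\<bar> \<le> upper A + neg.upper A" if "A \<in> P" for A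
    proof -
      have "A \<in> sets borel" using that P(3) by auto
      then have "ennreal (\<mu> A) \<le> upper A" "ennreal (- \<mu> A) \<le> neg.upper A"
        using le_upper[of A A] neg.le_upper[of A A] by auto
      then show ?thesis
        by (cases "\<mu> A \<ge> 0") (auto intro: add_increasing add_increasing2)
    qed
    then have "(\<Sum>A\<in>P. ennreal \<bar>\<mu> A\<bar>) \<le> (\<Sum>A\<in>P. upper A + neg.upper A)"
      by (rule sum_mono)
    also have "\<dots> = (\<Sum>A\<in>P. emeasure (pos_part \<mu>) A) + (\<Sum>A\<in>P. emeasure (neg_part \<mu>) A)"
      using P(3) by (auto simp: sum.distrib[symmetric] emeasure_pos_part emeasure_neg_part
          intro!: sum.cong)
    also have "\<dots> = emeasure (pos_part \<mu>) (\<Union>P) + emeasure (neg_part \<mu>) (\<Union>P)"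
      using P sum_emeasure[of "\<lambda>A. A" P "pos_part \<mu>"] sum_emeasure[of "\<lambda>A. A" P "neg_part \<mu>"]
      by (auto simp: disjoint_def disjoint_family_on_def)
    also have "\<dots> = upper E + neg.upper E"
      using E P(4) by (simp add: emeasure_pos_part emeasure_neg_part)
    finally show "(\<Sum>A\<in>P. ennreal \<bar>\<mu> A\<bar>) \<le> upper E + neg.upper E" .
  qed
  have "ennreal (\<mu> F) + ennreal (- \<mu> G) \<le> ?V"
    if F: "F \<in> sets borel" "F \<subseteq> E" and G: "G \<in> sets borel" "G \<subseteq> E" for F G
  proof -
    have V_le: "(\<Sum>A\<in>P. ennreal \<bar>\<mu> A\<bar>) \<le> ?V"
      if "finite P" "disjoint P" "P \<subseteq> sets borel" "\<Union>P = E" for P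
      using that by (intro SUP_upper) auto
    have single: "ennreal \<bar>\<mu> A\<bar> \<le> ?V" if A: "A \<in> sets borel" "A \<subseteq> E" for A
    proof -
      have "ennreal \<bar>\<mu> A\<bar> \<le> (\<Sum>B\<in>{A, E - A}. ennreal \<bar>\<mu> B\<bar>)"
        by (rule member_le_sum) auto
      also have "\<dots> \<le> ?V"
        using A E by (intro V_le) (auto simp: disjoint_def)
      finally show ?thesis .
    qed
    consider "\<mu> F < 0" | "\<mu> G > 0" | "0 \<le> \<mu> F" "\<mu> G \<le> 0" by linarith
    then show ?thesis
    proof cases
      case 1
      have "ennreal (\<mu> F) + ennreal (- \<mu> G) \<le> ennreal \<bar>\<mu> G\<bar>"
        using 1 by (auto simp: ennreal_neg intro!: ennreal_leI)
      then show ?thesis using single[OF G] by order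
    next
      case 2
      have "ennreal (\<mu> F) + ennreal (- \<mu> G) \<le> ennreal \<bar>\<mu> F\<bar>"
        using 2 by (auto simp: ennreal_neg intro!: ennreal_leI)
      then show ?thesis using single[OF F] by order
    next
      case 3
      \<comment> \<open>The values of \<open>\<mu>\<close> on \<open>F \<inter> G\<close> cancel in \<open>\<mu> F - \<mu> G\<close>, which leaves two disjoint sets.\<close>
      define A B where "A = F - G" and "B = G - F"
      have AB: "A \<in> sets borel" "B \<in> sets borel" "A \<inter> B = {}" "A \<subseteq> E" "B \<subseteq> E"
        using F G by (auto simp: A_def B_def)
      have "\<mu> F = \<mu> A + \<mu> (F \<inter> G)" "\<mu> G = \<mu> B + \<mu> (F \<inter> G)"
        using diff[of F "F \<inter> G"] diff[of G "F \<inter> G"] F G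
        by (auto simp: A_def B_def Diff_Int)
      then have "\<mu> F - \<mu> G \<le> \<bar>\<mu> A\<bar> + \<bar>\<mu> B\<bar>" by linarith
      then have "ennreal (\<mu> F) + ennreal (- \<mu> G) \<le> ennreal \<bar>\<mu> A\<bar> + ennreal \<bar>\<mu> B\<bar>"
        using 3 by (simp flip: ennreal_plus)
      also have "\<dots> \<le> ?V"
      proof (cases "A = B")
        case True
        then have "A = {}" "B = {}" using AB by auto
        then show ?thesis using single[of "{}"] empty by simp
      next
        case False
        then have "ennreal \<bar>\<mu> A\<bar> + ennreal \<bar>\<mu> B\<bar> = (\<Sum>C\<in>{A, B}. ennreal \<bar>\<mu> C\<bar>)"
          by simp
        also have "\<dots> \<le> (\<Sum>C\<in>{A, B, E - A - B}. ennreal \<bar>\<mu> C\<bar>)"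
          by (rule sum_mono2) auto
        also have "\<dots> \<le> ?V"
          using AB E by (intro V_le) (auto simp: disjoint_def)
        finally show ?thesis .
      qed
      finally show ?thesis .
    qed
  qed
  then show "upper E + neg.upper E \<le> ?V"
    unfolding upper_def[of E] neg.upper_def[of E]
    by (rule SUP_add_SUP_least[OF borel_subsets_nonempty borel_subsets_nonempty]) simp_all
qed

lemma variation_eq: "variation \<mu> = measure_of UNIV (sets borel) (\<lambda>E. upper E + neg.upper E)"
  unfolding variation_def
proof (rule measure_of_eq)
  fix E :: "'a set" assume "E \<in> sigma_sets UNIV (sets borel)"
  then have "E \<in> sets borel"
    by (simp add: sets.sigma_sets_eq[of borel, simplified])
  then show "(SUP P\<in>{P. finite P \<and> disjoint P \<and> P \<subseteq> sets borel \<and> \<Union>P = E}.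
      \<Sum>A\<in>P. ennreal \<bar>\<mu> A\<bar>) = upper E + neg.upper E"
    by (rule variation_sum_eq)
qed simp

lemma sets_variation [simp]: "sets (variation \<mu>) = sets borel"
  unfolding variation_eq by (simp add: sets.sigma_sets_eq[of borel, simplified])

lemma emeasure_variation:
  assumes "E \<in> sets borel"
  shows "emeasure (variation \<mu>) E = emeasure (pos_part \<mu>) E + emeasure (neg_part \<mu>) E"
proof -
  have "countably_additive (sets borel) (\<lambda>E. upper E + neg.upper E)"
    using upper_countably_additive neg.upper_countably_additive
    by (auto simp: countably_additive_def suminf_add[symmetric])
  then have "emeasure (variation \<mu>) E = upper E + neg.upper E"
    using assms upper_empty neg.upper_empty
    by (intro emeasure_measure_of[OF variation_eq]) (auto simp: positive_def)
  then show ?thesis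
    using assms by (simp add: emeasure_pos_part emeasure_neg_part)
qed

lemma finite_measure_parts:
  assumes "emeasure (variation \<mu>) UNIV < \<infinity>"
  shows "finite_measure (pos_part \<mu>)" "finite_measure (neg_part \<mu>)"
  using assms emeasure_variation[of UNIV]
    sets_eq_imp_space_eq[OF sets_pos_part] sets_eq_imp_space_eq[OF sets_neg_part]
  by (auto intro!: finite_measureI simp: less_top)

lemma jordan_decomposition:
  assumes fin: "emeasure (variation \<mu>) UNIV < \<infinity>" and E: "E \<in> sets borel"
  shows "\<mu> E = measure (pos_part \<mu>) E - measure (neg_part \<mu>) E"
proof -
  interpret P: finite_measure "pos_part \<mu>" by (rule finite_measure_parts[OF fin])
  interpret N: finite_measure "neg_part \<mu>" by (rule finite_measure_parts[OF fin])
  define p n where "p = measure (pos_part \<mu>) E" and "n = measure (neg_part \<mu>) E"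
  have p: "0 \<le> p" "upper E = ennreal p" and n: "0 \<le> n" "neg.upper E = ennreal n"
    using E P.emeasure_eq_measure[of E] N.emeasure_eq_measure[of E]
    by (simp_all add: p_def n_def emeasure_pos_part emeasure_neg_part)
  have "0 \<le> \<mu> E + n"
    using neg.le_upper[of E E] E n by simp
  then have 1: "p \<le> \<mu> E + n"
    using upper_le_add_lower[OF E n] p by simp
  have "0 \<le> - \<mu> E + p"
    using le_upper[of E E] E p by simp
  moreover have "ennreal n \<le> ennreal (- \<mu> E + p)"
    using signed_measure.upper_le_add_lower[OF uminus E p(1)] p(2) n by simp
  ultimately have "n \<le> - \<mu> E + p" by simp
  then show ?thesis using 1 by (simp add: p_def n_def)
qed

text \<open>
  The complement of the support is a union of open null sets; countably many of them suffice by
  Lindelof's theorem.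
\<close>

lemma variation_Compl_support: "emeasure (variation \<mu>) (- signed_support \<mu>) = 0"
proof -
  define \<U> where "\<U> = {U. open U \<and> emeasure (variation \<mu>) U = 0}"
  obtain \<V> where \<V>: "\<V> \<subseteq> \<U>" "countable \<V>" "\<Union>\<V> = \<Union>\<U>"
    using Lindelof[of \<U>] by (auto simp: \<U>_def)
  have "- signed_support \<mu> = \<Union>\<V>"
    unfolding \<V>(3) by (auto simp: signed_support_def \<U>_def not_less)
  moreover have "U \<in> null_sets (variation \<mu>)" if "U \<in> \<V>" for U
    using \<V>(1) that by (auto simp: \<U>_def null_sets_def)
  then have "\<Union>\<V> \<in> null_sets (variation \<mu>)"
    using null_sets_UN'[OF \<V>(2), of "\<lambda>U. U" "variation \<mu>"] by simp
  ultimately show ?thesis by auto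
qed

lemma zero_of_variation_zero:
  assumes "E \<in> sets borel" "emeasure (variation \<mu>) E = 0"
  shows "\<mu> E = 0"
proof -
  have "upper E = 0" "neg.upper E = 0"
    using assms emeasure_variation[of E] by (auto simp: emeasure_pos_part emeasure_neg_part)
  then show ?thesis
    using le_upper[of E E] neg.le_upper[of E E] assms(1) by (auto simp: ennreal_eq_0_iff)
qed

end

section \<open>Integrals against a cancelling measure\<close>

lemma integral_near_constant:
  fixes f :: "'b \<Rightarrow> real"
  assumes "finite_measure P" and [measurable]: "f \<in> borel_measurable P"
    and close: "AE y in P. \<bar>f y - k\<bar> \<le> M"
  shows "\<bar>integral\<^sup>L P f - k * measure P (space P)\<bar> \<le> M * measure P (space P)"
proof -
  interpret finite_measure P by fact
  have int: "integrable P (\<lambda>y. f y - k)"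
    using close by (intro integrable_const_bound[where B = M]) auto
  then have int_f: "integrable P f"
    using Bochner_Integration.integrable_add[OF int, of "\<lambda>_. k"] by simp
  have "integral\<^sup>L P f - k * measure P (space P) = (\<integral>y. f y - k \<partial>P)"
    using int_f by (simp add: mult.commute)
  also have "\<bar>\<dots>\<bar> \<le> (\<integral>y. \<bar>f y - k\<bar> \<partial>P)"
    by (rule integral_abs_bound)
  also have "\<dots> \<le> (\<integral>y. M \<partial>P)"
    using close int by (intro integral_mono_AE) auto
  finally show ?thesis by (simp add: mult.commute)
qed

text \<open>
  The constant \<open>k\<close> integrates to zero because the total mass of \<open>\<mu>\<close> vanishes. Its choice is free:
  \<open>k = 0\<close> gives the trivial bound by the supremum of \<open>f\<close>, and \<open>k = f c\<close> a bound by the oscillation.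
\<close>

lemma (in signed_measure) signed_integral_near_constant:
  assumes total: "emeasure (variation \<mu>) UNIV \<le> 1"
    and supp: "signed_support \<mu> \<subseteq> Q" and Q: "Q \<in> sets borel" and zero: "\<mu> Q = 0"
    and [measurable]: "f \<in> borel_measurable borel"
    and "0 \<le> M" and close: "\<And>y. y \<in> Q \<Longrightarrow> \<bar>f y - k\<bar> \<le> M"
  shows "\<bar>signed_integral \<mu> f\<bar> \<le> M"
proof -
  have fin: "emeasure (variation \<mu>) UNIV < \<infinity>"
    using total by (simp add: order_le_less_trans)
  interpret P: finite_measure "pos_part \<mu>" by (rule finite_measure_parts[OF fin])
  interpret N: finite_measure "neg_part \<mu>" by (rule finite_measure_parts[OF fin])
  have space: "space (pos_part \<mu>) = UNIV" "space (neg_part \<mu>) = UNIV"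
    using sets_eq_imp_space_eq[OF sets_pos_part] sets_eq_imp_space_eq[OF sets_neg_part] by auto
  have "emeasure (variation \<mu>) (- Q) \<le> emeasure (variation \<mu>) (- signed_support \<mu>)"
  proof (rule emeasure_mono)
    have "open (- signed_support \<mu>)"
      by (subst open_subopen) (auto simp: signed_support_def not_less)
    then show "- signed_support \<mu> \<in> sets (variation \<mu>)" by auto
  qed (use supp in auto)
  then have null: "emeasure (variation \<mu>) (- Q) = 0"
    using variation_Compl_support by simp
  have Compl_Q: "- Q \<in> sets borel" using Q by auto
  have "\<mu> UNIV = \<mu> Q + \<mu> (- Q)"
    using additive[OF Q Compl_Q] by (simp add: Compl_partition)
  then have "\<mu> UNIV = 0"
    using zero zero_of_variation_zero[OF Compl_Q null] by simp
  then have mass: "measure (pos_part \<mu>) UNIV = measure (neg_part \<mu>) UNIV"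
    using jordan_decomposition[OF fin, of UNIV] by simp
  have "- Q \<in> null_sets (pos_part \<mu>)" "- Q \<in> null_sets (neg_part \<mu>)"
    using null emeasure_variation[OF Compl_Q] Compl_Q by (auto simp: null_sets_def)
  then have "AE y in pos_part \<mu>. \<bar>f y - k\<bar> \<le> M" "AE y in neg_part \<mu>. \<bar>f y - k\<bar> \<le> M"
    using close by (auto intro!: AE_I'[where N = "- Q"])
  then have "\<bar>integral\<^sup>L (pos_part \<mu>) f - k * measure (pos_part \<mu>) UNIV\<bar>
        \<le> M * measure (pos_part \<mu>) UNIV"
      "\<bar>integral\<^sup>L (neg_part \<mu>) f - k * measure (neg_part \<mu>) UNIV\<bar>
        \<le> M * measure (neg_part \<mu>) UNIV"
    using integral_near_constant[OF P.finite_measure_axioms, of f k M]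
      integral_near_constant[OF N.finite_measure_axioms, of f k M]
    by (auto simp: space measurable_cong_sets[OF sets_pos_part refl]
        measurable_cong_sets[OF sets_neg_part refl])
  then have "\<bar>signed_integral \<mu> f\<bar>
      \<le> M * (measure (pos_part \<mu>) UNIV + measure (neg_part \<mu>) UNIV)"
    unfolding signed_integral_def using mass by (simp add: algebra_simps)
  also have "\<dots> \<le> M * 1"
  proof (rule mult_left_mono)
    have "ennreal (measure (pos_part \<mu>) UNIV + measure (neg_part \<mu>) UNIV) \<le> 1"
      using total emeasure_variation[of UNIV]
      by (simp add: P.emeasure_eq_measure N.emeasure_eq_measure)
    then show "measure (pos_part \<mu>) UNIV + measure (neg_part \<mu>) UNIV \<le> 1"
      by (simp only: ennreal_le_1)
  qed fact
  finally show ?thesis by simp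
qed

section \<open>The heat kernel as a function of the distance\<close>

definition heat_profile :: "real \<Rightarrow> real \<Rightarrow> real \<Rightarrow> real" where
  "heat_profile d t r = (4 * pi * t) powr (- (d / 2)) * exp (- r\<^sup>2 / (4 * t))"

lemma heat_eq_profile:
  fixes \<mu> :: "(real ^ 'n) set \<Rightarrow> real"
  shows "heat t \<mu> x = signed_integral \<mu> (\<lambda>y. heat_profile (real CARD('n)) t (norm (x - y)))"
  unfolding heat_def heat_profile_def ..

lemma power2_powr: "0 < r \<Longrightarrow> (r\<^sup>2) powr p = r powr (2 * p)" for r p :: real
  by (simp add: powr_def ln_realpow)

text \<open>
  With \<open>w = 4 p z\<close> this is \<open>ln z \<le> z\<close>, multiplied by \<open>p\<close> and exponentiated.
\<close>

lemma powr_mult_exp_le: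
  fixes p w :: real
  assumes "p > 0" "w > 0"
  shows "w powr p * exp (- w / 4) \<le> (4 * p) powr p"
proof -
  define z where "z = w / (4 * p)"
  have z: "z > 0" "w = (4 * p) * z" using assms by (auto simp: z_def)
  have "p * ln z \<le> p * z"
    using ln_le_minus_one[OF z(1)] assms by simp
  then have "z powr p \<le> exp (w / 4)"
    using z by (simp add: powr_def)
  then have "z powr p * exp (- w / 4) \<le> 1"
    by (simp add: exp_minus field_simps)
  then have "(4 * p) powr p * (z powr p * exp (- w / 4)) \<le> (4 * p) powr p"
    by (simp add: mult_left_le)
  moreover have "w powr p = (4 * p) powr p * z powr p"
    using z assms by (simp add: powr_mult)
  ultimately show ?thesis by (simp add: mult.assoc)
qed

lemma heat_profile_weight_le:
  assumes "0 \<le> d" "0 < t"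
  shows "t powr (\<alpha> / 2) * (4 * pi * t) powr (- (d / 2)) \<le> t powr (- ((d - \<alpha>) / 2))"
proof -
  have "1 \<le> 4 * pi" using pi_gt3 by simp
  then have "1 * t \<le> 4 * pi * t"
    using assms(2) by (intro mult_right_mono) auto
  then have "(4 * pi * t) powr (- (d / 2)) \<le> t powr (- (d / 2))"
    using assms by (intro powr_mono2') auto
  then have "t powr (\<alpha> / 2) * (4 * pi * t) powr (- (d / 2)) \<le> t powr (\<alpha> / 2) * t powr (- (d / 2))"
    by (intro mult_left_mono) auto
  also have "\<dots> = t powr (\<alpha> / 2 + - (d / 2))"
    by (rule powr_add[symmetric])
  also have "\<alpha> / 2 + - (d / 2) = - ((d - \<alpha>) / 2)"
    by (simp add: field_simps)
  finally show ?thesis .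
qed

text \<open>
  The bound of \<open>w powr p * exp (- w / 4)\<close> for the exponent \<open>s / 2 + 1\<close> that the derivative of the heat
  kernel produces, where \<open>s = d - \<alpha>\<close>.
\<close>

definition kernel_const :: "real \<Rightarrow> real" where
  "kernel_const s = (4 * (s / 2 + 1)) powr (s / 2 + 1)"

text \<open>
  In the scaling variable \<open>w = r\<^sup>2 / t\<close> the left-hand side is at most half of
  \<open>w powr (s / 2 + 1) * exp (- w / 4) * r powr (- s - 1)\<close>, where \<open>s = d - \<alpha>\<close>, and the factor
  depending on \<open>w\<close> is bounded. So the weight \<open>t powr (\<alpha> / 2)\<close> makes the radial derivative decay in
  \<open>r\<close> uniformly in \<open>t\<close>.
\<close>

lemma heat_profile_deriv_le:
  assumes "0 \<le> d" "\<alpha> < d" "0 < t" "0 < r"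
  shows "t powr (\<alpha> / 2) * ((4 * pi * t) powr (- (d / 2)) * (r / (2 * t) * exp (- r\<^sup>2 / (4 * t))))
    \<le> kernel_const (d - \<alpha>) * r powr (- (d - \<alpha>) - 1)" (is "?L \<le> _")
proof -
  define s q w where "s = d - \<alpha>" and "q = s / 2 + 1" and "w = r\<^sup>2 / t"
  have q: "q > 0" using assms by (simp add: s_def q_def add_pos_pos)
  have w: "w > 0" using assms by (simp add: w_def)
  have "w powr q = r powr (2 * q) / t powr q"
    using assms by (simp add: w_def powr_divide power2_powr)
  then have "w powr q = r powr (2 * q) * t powr (- q)"
    by (simp only: powr_minus divide_inverse)
  moreover have "2 * q = s + 2" and "- q = - (s / 2) - 1" by (auto simp: q_def)
  ultimately have wq: "w powr q = r powr (s + 2) * t powr (- (s / 2) - 1)"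
    by simp
  have rr: "r powr (s + 2) * r powr (- s - 1) = r"
    using assms by (simp add: powr_add[symmetric])
  have tt: "t powr (- (s / 2) - 1) = t powr (- (s / 2)) / t"
    using assms by (simp add: powr_diff)
  have "?L = (t powr (\<alpha> / 2) * (4 * pi * t) powr (- (d / 2))) * (r / (2 * t) * exp (- w / 4))"
    by (simp add: w_def mult.assoc)
  also have "\<dots> \<le> t powr (- (s / 2)) * (r / (2 * t) * exp (- w / 4))"
    unfolding s_def using assms by (intro mult_right_mono heat_profile_weight_le) auto
  also have "\<dots> = t powr (- (s / 2) - 1) * (r powr (s + 2) * r powr (- s - 1)) * exp (- w / 4) / 2"
    unfolding rr tt by simp
  also have "\<dots> = (w powr q * exp (- w / 4)) * r powr (- s - 1) / 2"
    unfolding wq by (simp only: ac_simps times_divide_eq_left times_divide_eq_right)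
  also have "\<dots> \<le> (w powr q * exp (- w / 4)) * r powr (- s - 1)"
    by simp
  also have "\<dots> \<le> kernel_const s * r powr (- s - 1)"
    unfolding kernel_const_def using powr_mult_exp_le[OF q w]
    by (intro mult_right_mono) (auto simp: q_def)
  finally show ?thesis by (simp add: s_def)
qed

lemma heat_profile_diff_le:
  assumes "0 \<le> d" "\<alpha> < d" "0 < t" "0 < m" "m \<le> u" "m \<le> v"
  shows "t powr (\<alpha> / 2) * \<bar>heat_profile d t u - heat_profile d t v\<bar>
    \<le> kernel_const (d - \<alpha>) * m powr (- (d - \<alpha>) - 1) * \<bar>u - v\<bar>"
proof -
  define f where "f r = t powr (\<alpha> / 2) * heat_profile d t r" for r
  define f' where "f' r = - (t powr (\<alpha> / 2) *
      ((4 * pi * t) powr (- (d / 2)) * (r / (2 * t) * exp (- r\<^sup>2 / (4 * t)))))" for r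
  have "norm (f u - f v) \<le> kernel_const (d - \<alpha>) * m powr (- (d - \<alpha>) - 1) * norm (u - v)"
  proof (rule field_differentiable_bound)
    fix r assume r: "r \<in> {m..}"
    show "(f has_field_derivative f' r) (at r within {m..})"
      unfolding f_def f'_def heat_profile_def using assms(3)
      by (auto intro!: derivative_eq_intros simp: field_simps)
    have "norm (f' r) \<le> kernel_const (d - \<alpha>) * r powr (- (d - \<alpha>) - 1)"
      using heat_profile_deriv_le[OF assms(1-3), of r] r assms by (simp add: f'_def abs_mult)
    also have "\<dots> \<le> kernel_const (d - \<alpha>) * m powr (- (d - \<alpha>) - 1)"
      using r assms by (intro mult_left_mono powr_mono2') (auto simp: kernel_const_def)
    finally show "norm (f' r) \<le> kernel_const (d - \<alpha>) * m powr (- (d - \<alpha>) - 1)" .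
  qed (use assms in auto)
  moreover have "f u - f v = t powr (\<alpha> / 2) * (heat_profile d t u - heat_profile d t v)"
    by (simp add: f_def right_diff_distrib)
  ultimately show ?thesis
    by (simp add: abs_mult)
qed

text \<open>
  Makes the heat kernel an admissible test function for weak-star convergence.
\<close>

lemma heat_profile_C0:
  fixes x :: "real ^ 'n"
  assumes "t > 0"
  shows "(\<lambda>y. heat_profile d t (norm (x - y))) \<in> C0_functions"
proof -
  have "filterlim (\<lambda>y. - norm x + norm y) at_top at_infinity"
    by (rule filterlim_tendsto_add_at_top[OF tendsto_const filterlim_norm_at_top])
  moreover have "- norm x + norm y \<le> norm (x - y)" for y
    using norm_triangle_ineq2[of y x] by (simp add: norm_minus_commute)
  ultimately have lim: "filterlim (\<lambda>y. norm (x - y)) at_top at_infinity"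
    by (rule filterlim_at_top_mono[OF _ always_eventually[OF allI]])
  have "filterlim (\<lambda>r::real. r\<^sup>2) at_top at_top"
    by (rule filterlim_pow_at_top[OF _ filterlim_ident]) simp
  moreover have "- (1 / (4 * t)) < 0"
    using assms by simp
  ultimately have "filterlim (\<lambda>r::real. - (1 / (4 * t)) * r\<^sup>2) at_bot at_top"
    by (intro filterlim_tendsto_neg_mult_at_bot[OF tendsto_const])
  also have "(\<lambda>r::real. - (1 / (4 * t)) * r\<^sup>2) = (\<lambda>r. - r\<^sup>2 / (4 * t))"
    by (simp add: fun_eq_iff)
  finally have "filterlim (\<lambda>r::real. - r\<^sup>2 / (4 * t)) at_bot at_top" .
  then have "((\<lambda>r. exp (- r\<^sup>2 / (4 * t))) \<longlongrightarrow> 0) at_top"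
    by (rule filterlim_compose[OF exp_at_bot])
  then have "(heat_profile d t \<longlongrightarrow> 0) at_top"
    unfolding heat_profile_def by (rule tendsto_mult_right_zero)
  then have "((\<lambda>y. heat_profile d t (norm (x - y))) \<longlongrightarrow> 0) at_infinity"
    by (rule filterlim_compose) (rule lim)
  moreover have "continuous_on UNIV (\<lambda>y. heat_profile d t (norm (x - y)))"
    unfolding heat_profile_def using assms by (auto intro!: continuous_intros)
  ultimately show ?thesis by (simp add: C0_functions_def)
qed

section \<open>Functions dominated by a sum over dyadic balls\<close>

lemma ex_dyadic_scale:
  fixes \<rho> R :: real
  assumes "0 < \<rho>" "\<rho> \<le> R"
  obtains k :: nat where "2 ^ k * \<rho> \<le> R" "R < 2 ^ Suc k * \<rho>"
proof -
  obtain n :: nat where n: "R / \<rho> < 2 ^ n"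
    using real_arch_pow[of 2 "R / \<rho>"] by auto
  then have ex: "R < 2 ^ n * \<rho>" using assms by (simp add: field_simps)
  define N where "N = (LEAST n. R < 2 ^ n * \<rho>)"
  have N: "R < 2 ^ N * \<rho>" unfolding N_def by (rule LeastI) (rule ex)
  then obtain k where k: "N = Suc k" using assms by (cases N) auto
  have "\<not> R < 2 ^ k * \<rho>"
    using not_less_Least[of k "\<lambda>n. R < 2 ^ n * \<rho>"] k by (simp add: N_def)
  then show ?thesis using that[of k] N k by simp
qed

text \<open>
  The dominating function is constant on the dyadic annuli around \<open>c\<close>. Since \<open>g\<close> decays one power
  faster than \<open>\<nu>\<close> can grow, the annulus at scale \<open>2 ^ k * \<rho>\<close> contributes at most a multiple of
  \<open>2 powr (- k)\<close>. Passing to \<open>G\<close> also removes any question of measurability of \<open>g\<close>, which will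
  be a supremum over uncountably many times.
\<close>

lemma dyadic_domination:
  fixes g :: "'a::euclidean_space \<Rightarrow> ennreal" and \<nu> :: "'a measure"
  assumes \<nu> [measurable_cong]: "sets \<nu> = sets borel"
    and growth: "\<And>r. r > 0 \<Longrightarrow> emeasure \<nu> (ball c r) \<le> ennreal (C' * r powr s)"
    and "0 \<le> C'" "0 \<le> M" "0 < \<rho>" "0 \<le> s"
    and near: "\<And>x. g x \<le> ennreal (M * \<rho> powr (- s))"
    and far: "\<And>x. \<rho> \<le> dist c x \<Longrightarrow> g x \<le> ennreal (M * \<rho> * dist c x powr (- s - 1))"
  obtains G where "G \<in> borel_measurable \<nu>" "\<And>x. g x \<le> G x"
    "(\<integral>\<^sup>+x. G x \<partial>\<nu>) \<le> ennreal (M * C' * 2 powr (s + 1))"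
proof -
  define A where "A k = M * \<rho> powr (- s) * (2 ^ k) powr (- s - 1)" for k :: nat
  define B where "B k = ball c (2 ^ Suc k * \<rho>)" for k :: nat
  define G where "G x = (\<Sum>k. ennreal (A k) * indicator (B k) x)" for x
  have A_nonneg: "0 \<le> A k" for k using assms by (simp add: A_def)
  have [measurable]: "B k \<in> sets \<nu>" for k using \<nu> by (simp add: B_def)
  have "G \<in> borel_measurable \<nu>"
    unfolding G_def by measurable
  moreover have "g x \<le> G x" for x
  proof -
    have "\<exists>k. x \<in> B k \<and> g x \<le> ennreal (A k)"
    proof (cases "\<rho> \<le> dist c x")
      case False
      then have "x \<in> B 0 \<and> g x \<le> ennreal (A 0)"
        using near[of x] \<open>0 < \<rho>\<close> by (simp add: A_def B_def)
      then show ?thesis by blast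
    next
      case True
      obtain k where k: "2 ^ k * \<rho> \<le> dist c x" "dist c x < 2 ^ Suc k * \<rho>"
        using ex_dyadic_scale[OF \<open>0 < \<rho>\<close> True] .
      have "dist c x powr (- s - 1) \<le> (2 ^ k * \<rho>) powr (- s - 1)"
        using k assms by (intro powr_mono2') auto
      also have "\<dots> = (2 ^ k) powr (- s - 1) * (\<rho> powr (- s) / \<rho>)"
        using assms by (simp add: powr_mult powr_diff)
      finally have "M * \<rho> * dist c x powr (- s - 1)
          \<le> M * \<rho> * ((2 ^ k) powr (- s - 1) * (\<rho> powr (- s) / \<rho>))"
        using assms by (intro mult_left_mono) auto
      also have "\<dots> = A k"
        using assms by (simp add: A_def)
      finally have "g x \<le> ennreal (A k)"
        using far[OF True] by (meson ennreal_leI order_trans)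
      then show ?thesis using k by (auto simp: B_def)
    qed
    then obtain k where "x \<in> B k" "g x \<le> ennreal (A k)" by blast
    then have "g x \<le> (\<Sum>k\<in>{k}. ennreal (A k) * indicator (B k) x)"
      by simp
    also have "\<dots> \<le> G x"
      unfolding G_def by (rule sum_le_suminf) auto
    finally show ?thesis .
  qed
  moreover have "(\<integral>\<^sup>+x. G x \<partial>\<nu>) \<le> ennreal (M * C' * 2 powr (s + 1))"
  proof -
    have "(\<integral>\<^sup>+x. G x \<partial>\<nu>) = (\<Sum>k. ennreal (A k) * emeasure \<nu> (B k))"
      unfolding G_def by (subst nn_integral_suminf) (auto simp: nn_integral_cmult_indicator)
    also have "\<dots> \<le> (\<Sum>k. ennreal (M * C' * 2 powr s * (1 / 2) ^ k))"
    proof (rule suminf_le)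
      fix k
      have "ennreal (A k) * emeasure \<nu> (B k) \<le> ennreal (A k) * ennreal (C' * (2 ^ Suc k * \<rho>) powr s)"
        unfolding B_def using assms by (intro mult_left_mono growth) auto
      also have "\<dots> = ennreal (A k * (C' * (2 ^ Suc k * \<rho>) powr s))"
        using A_nonneg assms by (simp add: ennreal_mult)
      also have "A k * (C' * (2 ^ Suc k * \<rho>) powr s) = M * C' * 2 powr s *
          (\<rho> powr (- s) * \<rho> powr s) * ((2 ^ k) powr (- s - 1) * (2 ^ k) powr s)"
        using assms by (simp add: A_def powr_mult)
      also have "\<rho> powr (- s) * \<rho> powr s = 1"
        using assms by (simp flip: powr_add)
      also have "(2 ^ k) powr (- s - 1) * (2 ^ k) powr s = (1 / 2 :: real) ^ k"
        by (simp add: powr_minus power_one_over inverse_eq_divide flip: powr_add)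
      finally show "ennreal (A k) * emeasure \<nu> (B k) \<le> ennreal (M * C' * 2 powr s * (1 / 2) ^ k)"
        by simp
    qed auto
    also have "\<dots> = ennreal (M * C' * 2 powr s * (1 / (1 - 1 / 2)))"
      using assms by (intro suminf_ennreal_eq sums_mult geometric_sums) auto
    also have "M * C' * 2 powr s * (1 / (1 - 1 / 2)) = M * C' * 2 powr (s + 1)"
      by (simp add: powr_add)
    finally show ?thesis .
  qed
  ultimately show ?thesis by (rule that)
qed

section \<open>The maximal function of an atom\<close>

lemma signed_measure_radon: "\<mu> \<in> signed_radon_measures \<Longrightarrow> signed_measure \<mu>"
  by unfold_locales (auto simp: signed_radon_measures_def)

text \<open>
  Everywhere, small times \<open>t \<le> l\<^sup>2\<close> are controlled by the smoothness condition on the atom and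
  large times by its mass alone. At distance at least \<open>2 * d * l\<close> from the corner \<open>c\<close>, the
  cancellation of the atom replaces the kernel by its oscillation on the cube, which gains the factor
  \<open>d * l\<close>, a bound for the distance of \<open>c\<close> to the points of the cube.
\<close>

lemma beta_atom_heat_bounds:
  fixes a :: "(real ^ 'n) set \<Rightarrow> real" and \<alpha> \<beta> :: real
  defines "d \<equiv> real CARD('n)"
  assumes atom: "beta_atom \<beta> a" and \<alpha>: "d - \<beta> \<le> \<alpha>" "\<alpha> < d"
  obtains c l where "0 < l"
    "\<And>x t. 0 < t \<Longrightarrow> t powr (\<alpha> / 2) * \<bar>heat t a x\<bar> \<le> l powr (- (d - \<alpha>))"
    "\<And>x t. 0 < t \<Longrightarrow> 2 * d * l \<le> dist c x \<Longrightarrow> t powr (\<alpha> / 2) * \<bar>heat t a x\<bar>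
        \<le> kernel_const (d - \<alpha>) * (dist c x / 2) powr (- (d - \<alpha>) - 1) * (d * l)"
proof -
  have d: "1 \<le> d" unfolding d_def by (simp add: Suc_leI)
  obtain c l where l: "0 < l"
    and supp: "signed_support a \<subseteq> cbox c (\<chi> i. c $ i + l)"
    and cancel: "a (cbox c (\<chi> i. c $ i + l)) = 0"
    and smooth: "\<And>x t. 0 < t \<Longrightarrow> \<bar>t powr ((d - \<beta>) / 2) * heat t a x\<bar> \<le> l powr (- \<beta>)"
    and mass: "emeasure (variation a) UNIV \<le> 1"
    using atom unfolding beta_atom_def Let_def d_def by blast
  define Q where "Q = cbox c (\<chi> i. c $ i + l)"
  interpret signed_measure a
    using atom by (intro signed_measure_radon) (simp add: beta_atom_def)
  have integral_bound: "\<bar>signed_integral a f\<bar> \<le> M"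
    if "f \<in> borel_measurable borel" "0 \<le> M" "\<And>y. y \<in> Q \<Longrightarrow> \<bar>f y - k\<bar> \<le> M" for f k M
    using signed_integral_near_constant[OF mass supp _ cancel that(1,2), of k] that(3)
    by (simp add: Q_def)
  have meas: "(\<lambda>y. heat_profile d t (norm (x - y))) \<in> borel_measurable borel" if "0 < t" for t and x :: "real ^ 'n"
    using heat_profile_C0[OF that, of d x]
    by (auto simp: C0_functions_def intro: borel_measurable_continuous_onI)
  have near: "t powr (\<alpha> / 2) * \<bar>heat t a x\<bar> \<le> l powr (- (d - \<alpha>))" if t: "0 < t" for x t
  proof (cases "t \<le> l\<^sup>2")
    case True
    have "t powr (\<alpha> / 2) = t powr ((\<alpha> - (d - \<beta>)) / 2) * t powr ((d - \<beta>) / 2)"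
      by (simp add: field_simps flip: powr_add)
    then have "t powr (\<alpha> / 2) * \<bar>heat t a x\<bar>
        = t powr ((\<alpha> - (d - \<beta>)) / 2) * \<bar>t powr ((d - \<beta>) / 2) * heat t a x\<bar>"
      by (simp add: abs_mult)
    also have "\<dots> \<le> (l\<^sup>2) powr ((\<alpha> - (d - \<beta>)) / 2) * l powr (- \<beta>)"
      using smooth[OF t, of x] True t \<alpha> by (intro mult_mono powr_mono2) auto
    also have "(l\<^sup>2) powr ((\<alpha> - (d - \<beta>)) / 2) = l powr (\<alpha> - (d - \<beta>))"
      unfolding power2_powr[OF l] by (rule arg_cong[where f = "(powr) l"]) (simp add: field_simps)
    also have "l powr (\<alpha> - (d - \<beta>)) * l powr (- \<beta>) = l powr (- (d - \<alpha>))"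
      by (simp flip: powr_add)
    finally show ?thesis .
  next
    case False
    have "\<bar>heat t a x\<bar> \<le> (4 * pi * t) powr (- (d / 2))"
      unfolding heat_eq_profile d_def[symmetric]
    proof (rule integral_bound[where k = 0])
      show "\<bar>heat_profile d t (norm (x - y)) - 0\<bar> \<le> (4 * pi * t) powr (- (d / 2))" for y
        using t by (auto simp: heat_profile_def abs_mult intro!: mult_left_le)
    qed (use meas[OF t] in auto)
    then have "t powr (\<alpha> / 2) * \<bar>heat t a x\<bar> \<le> t powr (\<alpha> / 2) * (4 * pi * t) powr (- (d / 2))"
      by (rule mult_left_mono) simp
    also have "\<dots> \<le> t powr (- ((d - \<alpha>) / 2))"
      using d t by (intro heat_profile_weight_le) auto
    also have "\<dots> \<le> (l\<^sup>2) powr (- ((d - \<alpha>) / 2))"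
      using False l \<alpha> by (intro powr_mono2') auto
    also have "\<dots> = l powr (- (d - \<alpha>))"
      unfolding power2_powr[OF l] by (rule arg_cong[where f = "(powr) l"]) (simp add: field_simps)
    finally show ?thesis .
  qed
  have far: "t powr (\<alpha> / 2) * \<bar>heat t a x\<bar>
      \<le> kernel_const (d - \<alpha>) * (dist c x / 2) powr (- (d - \<alpha>) - 1) * (d * l)" (is "_ \<le> ?B")
    if t: "0 < t" and x: "2 * d * l \<le> dist c x" for x t
  proof -
    have dl: "0 < d * l" using d l by simp
    have B: "0 \<le> ?B" using dl by (simp add: kernel_const_def)
    have "\<bar>heat t a x\<bar> \<le> ?B / t powr (\<alpha> / 2)"
      unfolding heat_eq_profile d_def[symmetric]
    proof (rule integral_bound[where k = "heat_profile d t (norm (x - c))"])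
      fix y assume y: "y \<in> Q"
      have "norm (y - c) \<le> (\<Sum>i\<in>UNIV. \<bar>(y - c) $ i\<bar>)"
        by (rule norm_le_l1_cart)
      also have "\<dots> \<le> (\<Sum>i\<in>(UNIV :: 'n set). l)"
        using y by (intro sum_mono) (auto simp: Q_def mem_box_cart abs_le_iff algebra_simps)
      finally have yc: "norm (y - c) \<le> d * l" by (simp add: d_def)
      have diff: "\<bar>norm (x - y) - norm (x - c)\<bar> \<le> d * l"
        using norm_triangle_ineq3[of "x - y" "x - c"] yc by (simp add: norm_minus_commute)
      have R: "dist c x = norm (x - c)" by (simp add: dist_norm norm_minus_commute)
      have "t powr (\<alpha> / 2) * \<bar>heat_profile d t (norm (x - y)) - heat_profile d t (norm (x - c))\<bar>
          \<le> kernel_const (d - \<alpha>) * (dist c x / 2) powr (- (d - \<alpha>) - 1)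
            * \<bar>norm (x - y) - norm (x - c)\<bar>"
        using d \<alpha> t x dl diff R by (intro heat_profile_diff_le) auto
      also have "\<dots> \<le> ?B"
        using diff by (intro mult_left_mono) (auto simp: kernel_const_def)
      finally show "\<bar>heat_profile d t (norm (x - y)) - heat_profile d t (norm (x - c))\<bar>
          \<le> ?B / t powr (\<alpha> / 2)"
        using t by (simp add: pos_le_divide_eq mult.commute)
    qed (use meas[OF t] B in auto)
    then show ?thesis
      using t by (simp add: pos_le_divide_eq mult.commute)
  qed
  show ?thesis using that[OF l near far] .
qed

text \<open>
  The value of \<open>M * C' * 2 powr (s + 1)\<close> in \<open>dyadic_domination\<close> when \<open>M\<close> is
  large enough for both bounds of \<open>beta_atom_heat_bounds\<close> at the radius \<open>\<rho> = 2 * d * l\<close>; the side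
  length \<open>l\<close> cancels.
\<close>

definition maximal_const :: "real \<Rightarrow> real \<Rightarrow> real \<Rightarrow> real" where
  "maximal_const d s C' = ((2 * d) powr s + kernel_const s * 2 powr s) * C' * 2 powr (s + 1)"

lemma beta_atom_maximal_dominated:
  fixes a :: "(real ^ 'n) set \<Rightarrow> real" and \<nu> :: "(real ^ 'n) measure" and \<alpha> \<beta> C' :: real
  defines "d \<equiv> real CARD('n)"
  assumes atom: "beta_atom \<beta> a" and \<alpha>: "d - \<beta> \<le> \<alpha>" "\<alpha> < d" and "0 \<le> C'"
    and \<nu>: "sets \<nu> = sets borel"
    and growth: "\<And>x r. 0 < r \<Longrightarrow> emeasure \<nu> (ball x r) \<le> ennreal (C' * r powr (d - \<alpha>))"
  shows "\<exists>G\<in>borel_measurable \<nu>.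
    (\<forall>x. (SUP t\<in>{0<..}. ennreal (t powr (\<alpha> / 2) * \<bar>heat t a x\<bar>)) \<le> G x) \<and>
    (\<integral>\<^sup>+x. G x \<partial>\<nu>) \<le> ennreal (maximal_const d (d - \<alpha>) C')"
proof -
  define s where "s = d - \<alpha>"
  have s: "0 < s" using \<alpha> by (simp add: s_def)
  have d: "1 \<le> d" unfolding d_def by (simp add: Suc_leI)
  obtain c l where l: "0 < l"
    and near: "\<And>x t. 0 < t \<Longrightarrow> t powr (\<alpha> / 2) * \<bar>heat t a x\<bar> \<le> l powr (- s)"
    and far: "\<And>x t. 0 < t \<Longrightarrow> 2 * d * l \<le> dist c x \<Longrightarrow> t powr (\<alpha> / 2) * \<bar>heat t a x\<bar>
        \<le> kernel_const s * (dist c x / 2) powr (- s - 1) * (d * l)"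
    using beta_atom_heat_bounds[OF atom \<alpha>[unfolded d_def]] unfolding s_def d_def by metis
  define \<rho> M where "\<rho> = 2 * d * l" and "M = (2 * d) powr s + kernel_const s * 2 powr s"
  have \<rho>: "0 < \<rho>" using d l by (simp add: \<rho>_def)
  have K: "0 \<le> kernel_const s" by (simp add: kernel_const_def)
  have M: "0 \<le> M" using K by (simp add: M_def)
  define g where "g x = (SUP t\<in>{0<..}. ennreal (t powr (\<alpha> / 2) * \<bar>heat t a x\<bar>))" for x
  have near': "g x \<le> ennreal (M * \<rho> powr (- s))" for x
    unfolding g_def
  proof (rule SUP_least)
    fix t :: real assume "t \<in> {0<..}"
    then have "t powr (\<alpha> / 2) * \<bar>heat t a x\<bar> \<le> l powr (- s)"
      using near by simp
    also have "l powr (- s) = ((2 * d) powr s * (2 * d) powr (- s)) * l powr (- s)"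
      using d by (simp flip: powr_add)
    also have "\<dots> = (2 * d) powr s * \<rho> powr (- s)"
      using d l by (simp only: \<rho>_def powr_mult mult.assoc)
    also have "\<dots> \<le> M * \<rho> powr (- s)"
      using K by (intro mult_right_mono) (auto simp: M_def)
    finally show "ennreal (t powr (\<alpha> / 2) * \<bar>heat t a x\<bar>) \<le> ennreal (M * \<rho> powr (- s))"
      by (rule ennreal_leI)
  qed
  have far': "g x \<le> ennreal (M * \<rho> * dist c x powr (- s - 1))" if x: "\<rho> \<le> dist c x" for x
    unfolding g_def
  proof (rule SUP_least)
    fix t :: real assume "t \<in> {0<..}"
    then have "t powr (\<alpha> / 2) * \<bar>heat t a x\<bar> \<le> kernel_const s * (dist c x / 2) powr (- s - 1) * (d * l)"
      using far x by (simp add: \<rho>_def)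
    also have "(dist c x / 2) powr (- s - 1) = dist c x powr (- s - 1) * (2 powr s * 2)"
      by (simp add: powr_divide powr_diff powr_minus field_simps)
    also have "kernel_const s * (dist c x powr (- s - 1) * (2 powr s * 2)) * (d * l)
        = (kernel_const s * 2 powr s) * \<rho> * dist c x powr (- s - 1)"
      by (simp add: \<rho>_def)
    also have "\<dots> \<le> M * \<rho> * dist c x powr (- s - 1)"
      using \<rho> by (intro mult_right_mono) (auto simp: M_def)
    finally show "ennreal (t powr (\<alpha> / 2) * \<bar>heat t a x\<bar>) \<le> ennreal (M * \<rho> * dist c x powr (- s - 1))"
      by (rule ennreal_leI)
  qed
  obtain G where "G \<in> borel_measurable \<nu>" "\<And>x. g x \<le> G x"
    "(\<integral>\<^sup>+x. G x \<partial>\<nu>) \<le> ennreal (M * C' * 2 powr (s + 1))"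
    using dyadic_domination[OF \<nu> growth[folded s_def] \<open>0 \<le> C'\<close> M \<rho> _ near' far'] s by auto
  then show ?thesis
    unfolding g_def maximal_const_def M_def s_def by blast
qed

section \<open>Passage to the weak-star limit\<close>

lemma heat_le_liminf_atoms:
  fixes \<mu> :: "(real ^ 'n) set \<Rightarrow> real" and G :: "nat \<Rightarrow> nat \<Rightarrow> real ^ 'n \<Rightarrow> ennreal"
  assumes rep: "atomic_representation \<beta> \<mu> c a" and t: "0 < t"
    and G: "\<And>n i. i \<in> {1..n} \<Longrightarrow> ennreal (t powr p * \<bar>heat t (a i n) x\<bar>) \<le> G i n x"
  shows "ennreal (t powr p * \<bar>heat t \<mu> x\<bar>)
    \<le> liminf (\<lambda>n. \<Sum>i=1..n. ennreal \<bar>c i n\<bar> * G i n x)"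
proof -
  have "(\<lambda>n. \<Sum>i=1..n. c i n * heat t (a i n) x) \<longlonglongrightarrow> heat t \<mu> x"
    using rep heat_profile_C0[OF t] unfolding atomic_representation_def heat_eq_profile by blast
  then have "(\<lambda>n. ennreal (t powr p * \<bar>\<Sum>i=1..n. c i n * heat t (a i n) x\<bar>))
      \<longlonglongrightarrow> ennreal (t powr p * \<bar>heat t \<mu> x\<bar>)"
    by (intro tendsto_intros)
  then have "ennreal (t powr p * \<bar>heat t \<mu> x\<bar>)
      = liminf (\<lambda>n. ennreal (t powr p * \<bar>\<Sum>i=1..n. c i n * heat t (a i n) x\<bar>))"
    by (rule lim_imp_Liminf[OF sequentially_bot, symmetric])
  also have "\<dots> \<le> liminf (\<lambda>n. \<Sum>i=1..n. ennreal \<bar>c i n\<bar> * G i n x)"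
  proof (intro Liminf_mono always_eventually allI)
    fix n
    have "t powr p * \<bar>\<Sum>i=1..n. c i n * heat t (a i n) x\<bar>
        \<le> t powr p * (\<Sum>i=1..n. \<bar>c i n * heat t (a i n) x\<bar>)"
      by (intro mult_left_mono sum_abs) simp
    also have "\<dots> = (\<Sum>i=1..n. \<bar>c i n\<bar> * (t powr p * \<bar>heat t (a i n) x\<bar>))"
      by (simp add: sum_distrib_left abs_mult mult_ac)
    finally have "ennreal (t powr p * \<bar>\<Sum>i=1..n. c i n * heat t (a i n) x\<bar>)
        \<le> ennreal (\<Sum>i=1..n. \<bar>c i n\<bar> * (t powr p * \<bar>heat t (a i n) x\<bar>))"
      by (rule ennreal_leI)
    also have "\<dots> = (\<Sum>i=1..n. ennreal \<bar>c i n\<bar> * ennreal (t powr p * \<bar>heat t (a i n) x\<bar>))"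
      by (subst sum_ennreal[symmetric]) (auto simp: ennreal_mult intro!: sum.cong)
    also have "\<dots> \<le> (\<Sum>i=1..n. ennreal \<bar>c i n\<bar> * G i n x)"
      using G by (intro sum_mono mult_left_mono) auto
    finally show "ennreal (t powr p * \<bar>\<Sum>i=1..n. c i n * heat t (a i n) x\<bar>)
        \<le> (\<Sum>i=1..n. ennreal \<bar>c i n\<bar> * G i n x)" .
  qed
  finally show ?thesis .
qed

lemma le_ennreal_mult_Inf:
  assumes "0 < C" "\<And>y. y \<in> S \<Longrightarrow> X \<le> ennreal C * y"
  shows "X \<le> ennreal C * Inf S"
proof -
  have "X / ennreal C \<le> y" if "y \<in> S" for y
    using assms(1) assms(2)[OF that] by (intro divide_le_posI_ennreal) auto
  then have "X / ennreal C \<le> Inf S"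
    by (rule Inf_greatest)
  then have "ennreal C * (X / ennreal C) \<le> ennreal C * Inf S"
    by (rule mult_left_mono) simp
  then show ?thesis
    using assms(1) by (simp add: ennreal_times_divide ennreal_mult_divide_eq mult.commute)
qed

text \<open>
  Fatou's lemma is applied to the measurable functions that dominate the maximal functions of the
  atoms, rather than to the maximal functions themselves.
\<close>

lemma maximal_integral_le_atomic_limsup:
  fixes \<mu> :: "(real ^ 'n) set \<Rightarrow> real" and \<nu> :: "(real ^ 'n) measure" and \<alpha> \<beta> C' :: real
  defines "d \<equiv> real CARD('n)"
  assumes rep: "atomic_representation \<beta> \<mu> c a"
    and \<alpha>: "d - \<beta> \<le> \<alpha>" "\<alpha> < d" and C': "0 < C'"
    and \<nu>: "sets \<nu> = sets borel"
    and growth: "\<And>x r. 0 < r \<Longrightarrow> emeasure \<nu> (ball x r) \<le> ennreal (C' * r powr (d - \<alpha>))"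
    and C: "C = maximal_const d (d - \<alpha>) C'" "0 < C"
  shows "(\<integral>\<^sup>+x. (SUP t\<in>{0<..}. ennreal (t powr (\<alpha> / 2) * \<bar>heat t \<mu> x\<bar>)) \<partial>\<nu>)
    \<le> ennreal C * atomic_limsup c"
proof -
  let ?u = "\<lambda>n. ennreal (\<Sum>i=1..n. \<bar>c i n\<bar>)"
  define dominates where "dominates a G \<longleftrightarrow> G \<in> borel_measurable \<nu> \<and>
      (\<forall>x. (SUP t\<in>{0<..}. ennreal (t powr (\<alpha> / 2) * \<bar>heat t a x\<bar>)) \<le> G x) \<and>
      (\<integral>\<^sup>+x. G x \<partial>\<nu>) \<le> ennreal C" for a G
  have "\<exists>G. dominates (a i n) G" if "i \<in> {1..n}" for i n
    using beta_atom_maximal_dominated[of \<beta> "a i n" \<alpha> C' \<nu>] rep that \<alpha> C' \<nu> growth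
    unfolding dominates_def C d_def atomic_representation_def by auto
  then obtain G where G: "\<And>i n. i \<in> {1..n} \<Longrightarrow> dominates (a i n) (G i n)"
    by metis
  then have [measurable]: "G i n \<in> borel_measurable \<nu>" if "i \<in> {1..n}" for i n
    using that by (auto simp: dominates_def)
  have dom: "ennreal (t powr (\<alpha> / 2) * \<bar>heat t (a i n) x\<bar>) \<le> G i n x"
    if "0 < t" "i \<in> {1..n}" for t i n x
    using G[OF that(2)] that(1) unfolding dominates_def by (auto simp: SUP_le_iff)
  have "(\<integral>\<^sup>+x. (SUP t\<in>{0<..}. ennreal (t powr (\<alpha> / 2) * \<bar>heat t \<mu> x\<bar>)) \<partial>\<nu>)
      \<le> (\<integral>\<^sup>+x. liminf (\<lambda>n. \<Sum>i=1..n. ennreal \<bar>c i n\<bar> * G i n x) \<partial>\<nu>)"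
    by (intro nn_integral_mono SUP_least heat_le_liminf_atoms[OF rep]) (auto intro: dom)
  also have "\<dots> \<le> liminf (\<lambda>n. \<integral>\<^sup>+x. (\<Sum>i=1..n. ennreal \<bar>c i n\<bar> * G i n x) \<partial>\<nu>)"
    by (rule nn_integral_liminf) measurable
  also have "\<dots> \<le> liminf (\<lambda>n. ennreal C * ?u n)"
  proof (intro Liminf_mono always_eventually allI)
    fix n
    have "(\<integral>\<^sup>+x. (\<Sum>i=1..n. ennreal \<bar>c i n\<bar> * G i n x) \<partial>\<nu>)
        = (\<Sum>i=1..n. ennreal \<bar>c i n\<bar> * (\<integral>\<^sup>+x. G i n x \<partial>\<nu>))"
      by (subst nn_integral_sum) (auto intro!: sum.cong nn_integral_cmult)
    also have "\<dots> \<le> (\<Sum>i=1..n. ennreal \<bar>c i n\<bar> * ennreal C)"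
      using G by (intro sum_mono mult_left_mono) (auto simp: dominates_def)
    also have "\<dots> = ennreal C * ?u n"
      by (simp add: sum_distrib_left mult.commute flip: sum_ennreal)
    finally show "(\<integral>\<^sup>+x. (\<Sum>i=1..n. ennreal \<bar>c i n\<bar> * G i n x) \<partial>\<nu>) \<le> ennreal C * ?u n" .
  qed
  also have "\<dots> \<le> limsup (\<lambda>n. ennreal C * ?u n)"
    by (rule Liminf_le_Limsup) simp
  also have "\<dots> \<le> ennreal C * limsup ?u"
    unfolding limsup_INF_SUP
    by (rule le_ennreal_mult_Inf[OF C(2)])
       (auto simp: SUP_mult_left_ennreal intro!: INF_lower)
  finally show ?thesis by (simp add: atomic_limsup_def)
qed

theorem theorem3:
  fixes \<alpha> \<beta> C' :: real
  assumes "0 < \<beta>" and "\<beta> \<le> real CARD('n)"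
    and "real CARD('n) - \<beta> \<le> \<alpha>" and "\<alpha> < real CARD('n)"
    and "C' > 0"
  shows "\<exists>C>0. \<forall>(\<nu> :: (real ^ 'n) measure) (\<mu> :: (real ^ 'n) set \<Rightarrow> real).
           radon_measure \<nu> \<longrightarrow>
           (\<forall>x. \<forall>r>0. emeasure \<nu> (ball x r) \<le> ennreal (C' * r powr (real CARD('n) - \<alpha>))) \<longrightarrow>
           \<mu> \<in> DS \<beta> \<longrightarrow>
           (\<integral>\<^sup>+x. (SUP t\<in>{0<..}. ennreal (t powr (\<alpha> / 2) * \<bar>heat t \<mu> x\<bar>)) \<partial>\<nu>)
             \<le> ennreal C * DS_norm \<beta> \<mu>"
proof -
  define C where "C = maximal_const (real CARD('n)) (real CARD('n) - \<alpha>) C'"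
  have C: "0 < C"
    using assms(5) unfolding C_def maximal_const_def kernel_const_def
    by (intro mult_pos_pos add_pos_nonneg) auto
  show ?thesis
  proof (intro exI[of _ C] conjI allI impI)
    fix \<nu> :: "(real ^ 'n) measure" and \<mu> :: "(real ^ 'n) set \<Rightarrow> real"
    assume \<nu>: "radon_measure \<nu>"
      and growth: "\<forall>x. \<forall>r>0. emeasure \<nu> (ball x r) \<le> ennreal (C' * r powr (real CARD('n) - \<alpha>))"
    show "(\<integral>\<^sup>+x. (SUP t\<in>{0<..}. ennreal (t powr (\<alpha> / 2) * \<bar>heat t \<mu> x\<bar>)) \<partial>\<nu>)
        \<le> ennreal C * DS_norm \<beta> \<mu>"
      unfolding DS_norm_def
    proof (rule le_ennreal_mult_Inf[OF C])
      fix y assume "y \<in> {atomic_limsup c | c a. atomic_representation \<beta> \<mu> c a}"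
      then obtain c a where "y = atomic_limsup c" "atomic_representation \<beta> \<mu> c a"
        by blast
      then show "(\<integral>\<^sup>+x. (SUP t\<in>{0<..}. ennreal (t powr (\<alpha> / 2) * \<bar>heat t \<mu> x\<bar>)) \<partial>\<nu>)
          \<le> ennreal C * y"
        using maximal_integral_le_atomic_limsup[of \<beta> \<mu> c a \<alpha> C' \<nu> C] assms(3-5) C \<nu> growth
        by (simp add: C_def radon_measure_def)
    qed
  qed (rule C)
qed

end
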